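(* Let $\precsim$ be a preorder on $Y$. If $u: Y\to(0,1)$ is a weak-utility for $\precsim$, then the function $d^3_\precsim: Y\times Y\to\mathbb{R}^{+}$ defined by $$d^3_\precsim(x,y)=\begin{cases} 0, & x\precsim y,\\ 1+|u(x)-u(y)|, & y\prec x,\\ 1, & \text{otherwise,}\end{cases}$$ is a quasi-pseudo-metric such that $\tau_{d^3_\precsim}=\tau_A^{\precsim}$. Therefore, $\precsim$ is lower $\tau_{d^3_\precsim}$-continuous.
   Context: $\mathbb{R}^+=[0,\infty)$. A preorder is a reflexive transitive relation on a non-empty set; $y\prec x$ means $y\precsim x$ and not $x\precsim y$. A weak-utility for $\precsim$ is an isotonic real-valued function: $x\precsim y$ implies $u(x)\le u(y)$. A quasi-pseudo-metric on $Y$ is a function $q:Y\times Y\to\mathbb{R}^+$ with $q(x,x)=0$ and $q(x,z)\le q(x,y)+q(y,z)$; it induces the topology $\tau_q$ with base the balls $B_q(x,\varepsilon)=\{y\in Y: q(x,y)<\varepsilon\}$, $\varepsilon>0$. The Alexandroff topology $\tau_A^{\precsim}$ consists of all up-sets of $\precsim$, i.e. sets $G\subseteq Y$ such that $x\in G$ and $x\precsim y$ imply $y\in G$. $\precsim$ is lower $\tau$-continuous if $\{x\in Y: x\precsim y\}$ is $\tau$-closed for every $y\in Y$. *)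

theory Defs
  imports "HOL-Analysis.Analysis"
begin

text \<open>A preorder on \<open>Y\<close> is represented by a relation \<open>r\<close> with \<open>preorder_on Y r\<close>;
  \<open>(x, y) \<in> r\<close> reads ``\<open>x\<close> is weakly below \<open>y\<close>''. Functions with domain \<open>Y\<close> are
  total functions constrained on \<open>Y\<close> only.\<close>

definition strictly_below :: "'a rel \<Rightarrow> 'a \<Rightarrow> 'a \<Rightarrow> bool" where
  "strictly_below r y x \<longleftrightarrow> (y, x) \<in> r \<and> (x, y) \<notin> r"

definition weak_utility_on :: "'a set \<Rightarrow> 'a rel \<Rightarrow> ('a \<Rightarrow> real) \<Rightarrow> bool" where
  "weak_utility_on Y r u \<longleftrightarrow> (\<forall>x\<in>Y. \<forall>y\<in>Y. (x, y) \<in> r \<longrightarrow> u x \<le> u y)"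

definition quasi_pseudo_metric_on :: "'a set \<Rightarrow> ('a \<Rightarrow> 'a \<Rightarrow> real) \<Rightarrow> bool" where
  "quasi_pseudo_metric_on Y q \<longleftrightarrow>
     (\<forall>x\<in>Y. \<forall>y\<in>Y. 0 \<le> q x y) \<and>
     (\<forall>x\<in>Y. q x x = 0) \<and>
     (\<forall>x\<in>Y. \<forall>y\<in>Y. \<forall>z\<in>Y. q x z \<le> q x y + q y z)"

definition qball :: "'a set \<Rightarrow> ('a \<Rightarrow> 'a \<Rightarrow> real) \<Rightarrow> 'a \<Rightarrow> real \<Rightarrow> 'a set" where
  "qball Y q x e = {y \<in> Y. q x y < e}"

text \<open>Having the balls as a base means that the open sets are exactly the unions of balls.
  The constant is meaningful only if \<open>q\<close> is a quasi-pseudo-metric on \<open>Y\<close>, cf.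
  \<open>openin_qtopology\<close> below.\<close>

definition qtopology :: "'a set \<Rightarrow> ('a \<Rightarrow> 'a \<Rightarrow> real) \<Rightarrow> 'a topology" where
  "qtopology Y q = topology (arbitrary union_of (\<lambda>B. \<exists>x\<in>Y. \<exists>e>0. B = qball Y q x e))"

definition alexandroff_topology :: "'a set \<Rightarrow> 'a rel \<Rightarrow> 'a topology" where
  "alexandroff_topology Y r =
     topology (\<lambda>G. G \<subseteq> Y \<and> (\<forall>x\<in>G. \<forall>y\<in>Y. (x, y) \<in> r \<longrightarrow> y \<in> G))"

definition lower_continuous :: "'a set \<Rightarrow> 'a rel \<Rightarrow> 'a topology \<Rightarrow> bool" where
  "lower_continuous Y r T \<longleftrightarrow> (\<forall>y\<in>Y. closedin T {x \<in> Y. (x, y) \<in> r})"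

definition d3 :: "'a rel \<Rightarrow> ('a \<Rightarrow> real) \<Rightarrow> 'a \<Rightarrow> 'a \<Rightarrow> real" where
  "d3 r u x y =
     (if (x, y) \<in> r then 0
      else if strictly_below r y x then 1 + \<bar>u x - u y\<bar>
      else 1)"

lemma openin_alexandroff_topology:
  "openin (alexandroff_topology Y r) G \<longleftrightarrow>
     G \<subseteq> Y \<and> (\<forall>x\<in>G. \<forall>y\<in>Y. (x, y) \<in> r \<longrightarrow> y \<in> G)"
proof -
  have "istopology (\<lambda>G. G \<subseteq> Y \<and> (\<forall>x\<in>G. \<forall>y\<in>Y. (x, y) \<in> r \<longrightarrow> y \<in> G))"
    unfolding istopology_def by blast
  then show ?thesis
    by (simp add: alexandroff_topology_def topology_inverse')
qed

lemma topspace_alexandroff_topology: "topspace (alexandroff_topology Y r) = Y"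
  unfolding topspace_def openin_alexandroff_topology by blast

lemma union_of_qballs_iff:
  assumes "quasi_pseudo_metric_on Y q"
  shows "(arbitrary union_of (\<lambda>B. \<exists>x\<in>Y. \<exists>e>0. B = qball Y q x e)) G \<longleftrightarrow>
     G \<subseteq> Y \<and> (\<forall>x\<in>G. \<exists>e>0. qball Y q x e \<subseteq> G)"
    (is "(arbitrary union_of ?B) G \<longleftrightarrow> ?R")
proof
  assume "(arbitrary union_of ?B) G"
  then obtain U where U: "\<And>B. B \<in> U \<Longrightarrow> ?B B" and G: "G = \<Union>U"
    unfolding union_of_def by blast
  have "\<exists>e>0. qball Y q x e \<subseteq> G" if "x \<in> G" for x
  proof -
    obtain B where B: "B \<in> U" "x \<in> B" using \<open>x \<in> G\<close> G by blast
    obtain a d where a: "a \<in> Y" "B = qball Y q a d" using U[OF B(1)] by blast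
    have x: "x \<in> Y" "q a x < d" using B(2) a(2) by (auto simp: qball_def)
    have "qball Y q x (d - q a x) \<subseteq> B"
    proof
      fix z assume "z \<in> qball Y q x (d - q a x)"
      then have z: "z \<in> Y" "q x z < d - q a x" by (auto simp: qball_def)
      have "q a z \<le> q a x + q x z"
        using assms a(1) x(1) z(1) unfolding quasi_pseudo_metric_on_def by blast
      then show "z \<in> B" using z a(2) by (simp add: qball_def)
    qed
    then have "qball Y q x (d - q a x) \<subseteq> G" using B(1) G by blast
    moreover have "0 < d - q a x" using x by simp
    ultimately show ?thesis by blast
  qed
  moreover have "G \<subseteq> Y"
  proof
    fix z assume "z \<in> G"
    then obtain B where "B \<in> U" "z \<in> B" using G by blast
    then show "z \<in> Y" using U[of B] by (auto simp: qball_def)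
  qed
  ultimately show ?R by blast
next
  assume R: ?R
  have "\<exists>B. ?B B \<and> x \<in> B \<and> B \<subseteq> G" if "x \<in> G" for x
  proof -
    obtain e where e: "e > 0" "qball Y q x e \<subseteq> G" using R \<open>x \<in> G\<close> by blast
    have x: "x \<in> Y" using R \<open>x \<in> G\<close> by blast
    then have "q x x = 0" using assms unfolding quasi_pseudo_metric_on_def by blast
    then have "x \<in> qball Y q x e" using x e by (simp add: qball_def)
    then show ?thesis using e x by blast
  qed
  then show "(arbitrary union_of ?B) G"
    unfolding arbitrary_union_of_alt by blast
qed

lemma openin_qtopology:
  assumes "quasi_pseudo_metric_on Y q"
  shows "openin (qtopology Y q) G \<longleftrightarrow> G \<subseteq> Y \<and> (\<forall>x\<in>G. \<exists>e>0. qball Y q x e \<subseteq> G)"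
proof -
  define L where "L = (\<lambda>G. G \<subseteq> Y \<and> (\<forall>x\<in>G. \<exists>e>0. qball Y q x e \<subseteq> G))"
  have eq: "arbitrary union_of (\<lambda>B. \<exists>x\<in>Y. \<exists>e>0. B = qball Y q x e) = L"
    unfolding L_def by (rule ext) (rule union_of_qballs_iff[OF assms])
  have inter: "L (S \<inter> T)" if S: "L S" and T: "L T" for S T
  proof -
    have "\<exists>e>0. qball Y q x e \<subseteq> S \<inter> T" if x: "x \<in> S \<inter> T" for x
    proof -
      obtain d e where "d > 0" "qball Y q x d \<subseteq> S" "e > 0" "qball Y q x e \<subseteq> T"
        using S T x unfolding L_def by blast
      then have "min d e > 0" "qball Y q x (min d e) \<subseteq> S \<inter> T"
        by (auto simp: qball_def)
      then show ?thesis by blast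
    qed
    then show ?thesis using S unfolding L_def by blast
  qed
  have union: "L (\<Union>K)" if K: "\<forall>S\<in>K. L S" for K
    unfolding L_def
  proof (intro conjI ballI)
    show "\<Union>K \<subseteq> Y" using K unfolding L_def by blast
    fix x assume "x \<in> \<Union>K"
    then obtain S where S: "S \<in> K" "x \<in> S" by blast
    have "L S" using K S(1) by (rule bspec)
    then obtain e where e: "e > 0" "qball Y q x e \<subseteq> S" using S(2) unfolding L_def by blast
    have "qball Y q x e \<subseteq> \<Union>K" using e(2) Union_upper[OF S(1)] by (rule subset_trans)
    then show "\<exists>e>0. qball Y q x e \<subseteq> \<Union>K" using e(1) by blast
  qed
  have "istopology L"
    unfolding istopology_def using inter union by blast
  then have "openin (qtopology Y q) = L"
    unfolding qtopology_def eq by (rule topology_inverse')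
  then show ?thesis
    by (simp add: L_def)
qed

lemma topspace_qtopology:
  assumes "quasi_pseudo_metric_on Y q"
  shows "topspace (qtopology Y q) = Y"
proof (rule subset_antisym)
  have "\<exists>e>0. qball Y q x e \<subseteq> Y" for x
    by (rule exI[of _ 1]) (auto simp: qball_def)
  then have "openin (qtopology Y q) Y"
    unfolding openin_qtopology[OF assms] by simp
  then show "Y \<subseteq> topspace (qtopology Y q)"
    by (rule openin_subset)
  have "openin (qtopology Y q) (topspace (qtopology Y q))"
    by (rule openin_topspace)
  then show "topspace (qtopology Y q) \<subseteq> Y"
    unfolding openin_qtopology[OF assms] by (rule conjunct1)
qed

end

theory Submission
  imports Defs
begin

text \<open>
  The function \<open>d3\<close> vanishes exactly on the preorder and is at least \<open>1\<close> off it, so the balls of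
  radius at most \<open>1\<close> are the principal up-sets, which form a base of the Alexandroff topology.
  For the triangle inequality, let \<open>x\<close> be not below \<open>z\<close>; then at least one of the two steps
  \<open>x\<close> to \<open>y\<close> and \<open>y\<close> to \<open>z\<close> leaves the preorder. If both do, the right-hand side is
  at least \<open>2\<close>, while \<open>d3 < 2\<close> because \<open>u\<close> takes values in an interval of length \<open>1\<close>. If only one does
  and \<open>z\<close> is strictly below \<open>x\<close>, that step is strictly decreasing as well, and monotonicity of \<open>u\<close> along
  the other step makes its drop in \<open>u\<close> at least as large.
\<close>

lemma d3_nonneg: "0 \<le> d3 r u x y"
  by (simp add: d3_def)

lemma d3_ge_1: "(x, y) \<notin> r \<Longrightarrow> 1 \<le> d3 r u x y"
  by (simp add: d3_def)

lemma d3_less_1_iff: "d3 r u x y < 1 \<longleftrightarrow> (x, y) \<in> r"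
  using d3_ge_1[of x y r u] by (auto simp: d3_def)

lemma d3_less_2:
  assumes "u \<in> Y \<rightarrow> {0<..<1}" "x \<in> Y" "y \<in> Y"
  shows "d3 r u x y < 2"
proof -
  have "u x \<in> {0<..<1}" "u y \<in> {0<..<1}"
    using assms by auto
  then show ?thesis
    by (auto simp: d3_def)
qed

lemma d3_triangle:
  assumes r: "preorder_on Y r" and u: "u \<in> Y \<rightarrow> {0<..<1}" and mono: "weak_utility_on Y r u"
    and Y: "x \<in> Y" "y \<in> Y" "z \<in> Y"
  shows "d3 r u x z \<le> d3 r u x y + d3 r u y z"
proof -
  have trans: "(a, c) \<in> r" if "(a, b) \<in> r" "(b, c) \<in> r" for a b c
    using r that by (auto simp: preorder_on_def dest: transD)
  have le: "u a \<le> u b" if "(a, b) \<in> r" "a \<in> Y" "b \<in> Y" for a b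
    using mono that unfolding weak_utility_on_def by blast
  consider "(x, z) \<in> r" | "(x, z) \<notin> r" "(x, y) \<in> r" | "(x, z) \<notin> r" "(y, z) \<in> r"
    | "(x, y) \<notin> r" "(y, z) \<notin> r"
    by blast
  then show ?thesis
  proof cases
    case 1
    then show ?thesis
      using d3_nonneg[of r u x y] d3_nonneg[of r u y z] by (simp add: d3_def)
  next
    case 2
    have yz: "(y, z) \<notin> r"
      using 2 trans by blast
    show ?thesis
    proof (cases "(z, x) \<in> r")
      case True
      then have "(z, y) \<in> r"
        using 2 trans by blast
      \<comment> \<open>Here \<open>u z\<close> \<le> \<open>u x\<close> \<le> \<open>u y\<close>,
        so the drop from \<open>y\<close> to \<open>z\<close> contains the drop from
        \<open>x\<close> to \<open>z\<close>.\<close>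
      then show ?thesis
        using 2 yz True le[of z x] le[of x y] Y by (simp add: d3_def strictly_below_def)
    next
      case False
      \<comment> \<open>The left-hand side is exactly 1, which the step from \<open>y\<close> to
        \<open>z\<close> alone already costs.\<close>
      then show ?thesis
        using 2 yz by (simp add: d3_def strictly_below_def)
    qed
  next
    case 3
    have xy: "(x, y) \<notin> r"
      using 3 trans by blast
    show ?thesis
    proof (cases "(z, x) \<in> r")
      case True
      then have "(y, x) \<in> r"
        using 3 trans by blast
      \<comment> \<open>Mirror image of the previous case: \<open>u y\<close> \<le>
        \<open>u z\<close> \<le> \<open>u x\<close>.\<close>
      then show ?thesis
        using 3 xy True le[of z x] le[of y z] Y by (simp add: d3_def strictly_below_def)
    next
      case False
      then show ?thesis
        using 3 xy by (simp add: d3_def strictly_below_def)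
    qed
  next
    case 4
    then show ?thesis
      using d3_ge_1[of x y r u] d3_ge_1[of y z r u] d3_less_2[OF u Y(1,3), of r] by linarith
  qed
qed

lemma quasi_pseudo_metric_on_d3:
  assumes "preorder_on Y r" "u \<in> Y \<rightarrow> {0<..<1}" "weak_utility_on Y r u"
  shows "quasi_pseudo_metric_on Y (d3 r u)"
proof -
  have "refl_on Y r"
    using assms(1) by (simp add: preorder_on_def)
  then have "d3 r u x x = 0" if "x \<in> Y" for x
    using that by (simp add: d3_def refl_onD)
  then show ?thesis
    unfolding quasi_pseudo_metric_on_def by (simp add: d3_nonneg d3_triangle[OF assms])
qed

text \<open>The up-set of \<open>x\<close> in \<open>Y\<close> is the least ball around
  \<open>x\<close>: it lies in every such ball and is the one of radius 1. So some ball around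
  \<open>x\<close> fits into \<open>G\<close> iff this up-set does.\<close>

lemma qtopology_d3:
  assumes "quasi_pseudo_metric_on Y (d3 r u)"
  shows "qtopology Y (d3 r u) = alexandroff_topology Y r"
proof -
  have ball_1: "qball Y (d3 r u) x 1 = {y \<in> Y. (x, y) \<in> r}" for x
    by (simp add: qball_def d3_less_1_iff)
  have upset_subset: "{y \<in> Y. (x, y) \<in> r} \<subseteq> qball Y (d3 r u) x e" if "e > 0" for x e
    using that by (auto simp: qball_def d3_def)
  have ball_iff: "(\<exists>e>0. qball Y (d3 r u) x e \<subseteq> G) \<longleftrightarrow> {y \<in> Y. (x, y) \<in> r} \<subseteq> G" for x G
  proof
    assume "\<exists>e>0. qball Y (d3 r u) x e \<subseteq> G"
    then obtain e where "e > 0" "qball Y (d3 r u) x e \<subseteq> G"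
      by blast
    then show "{y \<in> Y. (x, y) \<in> r} \<subseteq> G"
      using upset_subset[of e x] by simp
  next
    assume "{y \<in> Y. (x, y) \<in> r} \<subseteq> G"
    then have "qball Y (d3 r u) x 1 \<subseteq> G"
      unfolding ball_1 .
    then show "\<exists>e>0. qball Y (d3 r u) x e \<subseteq> G"
      using zero_less_one by blast
  qed
  show ?thesis
    unfolding topology_eq openin_qtopology[OF assms] openin_alexandroff_topology ball_iff
    by (auto simp: subset_iff)
qed

text \<open>By transitivity, whatever lies above a point that is not below \<open>y\<close> is not
  below \<open>y\<close> either.\<close>

lemma lower_continuous_alexandroff_topology:
  assumes "trans r"
  shows "lower_continuous Y r (alexandroff_topology Y r)"
  unfolding lower_continuous_def closedin_def topspace_alexandroff_topology
    openin_alexandroff_topology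
proof (intro ballI conjI impI)
  fix y a b
  assume "a \<in> Y - {x \<in> Y. (x, y) \<in> r}" "b \<in> Y" "(a, b) \<in> r"
  then show "b \<in> Y - {x \<in> Y. (x, y) \<in> r}"
    using transD[OF assms, of a b y] by blast
qed auto

theorem theorem24:
  fixes Y :: "'a set" and r :: "'a rel" and u :: "'a \<Rightarrow> real"
  assumes "Y \<noteq> {}"
    and "preorder_on Y r"
    and "u \<in> Y \<rightarrow> {0<..<1}"
    and "weak_utility_on Y r u"
  shows "quasi_pseudo_metric_on Y (d3 r u)
    \<and> qtopology Y (d3 r u) = alexandroff_topology Y r
    \<and> lower_continuous Y r (qtopology Y (d3 r u))"
proof -
  have q: "quasi_pseudo_metric_on Y (d3 r u)"
    using assms(2-4) by (rule quasi_pseudo_metric_on_d3)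
  moreover have "trans r"
    using assms(2) by (simp add: preorder_on_def)
  ultimately show ?thesis
    by (simp add: qtopology_d3 lower_continuous_alexandroff_topology)
qed

end
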